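(* Let $1\le p<\infty$ and let $\Omega_0=\mathbb{Z}^2\setminus\bigl(\{0\}\times(\mathbb{Z}\setminus\{0\})\bigr)$. Then for every $M\in L^{p}(\mathbb{T}^{2})$ the system $\{M(x,y)e^{ikx}e^{imy}:(k,m)\in\Omega_0\}$ is not both complete and minimal in $L^{p}(\mathbb{T}^{2})$.
   Context: $\mathbb{T}=\mathbb{R}/2\pi\mathbb{Z}$ with Lebesgue measure; functions are complex valued. A system in a Banach space is complete if its closed linear span is the whole space, and minimal if no element lies in the closed linear span of the others. *)

theory Defs
  imports "HOL-Analysis.Analysis" "HOL-Library.Function_Algebras"
begin

text \<open>
  \<open>L\<^sup>p\<close> is handled through representatives and the \<open>L\<^sup>p\<close> seminorm; functions agreeing
  almost everywhere are at distance 0, so closedness and density agree with those in the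
  quotient Banach space.
\<close>

definition Lp_space :: "real \<Rightarrow> 'a measure \<Rightarrow> ('a \<Rightarrow> complex) set" where
  "Lp_space p \<mu> = {f \<in> borel_measurable \<mu>. integrable \<mu> (\<lambda>x. norm (f x) powr p)}"

definition Lp_norm :: "real \<Rightarrow> 'a measure \<Rightarrow> ('a \<Rightarrow> complex) \<Rightarrow> real" where
  "Lp_norm p \<mu> f = (LINT x|\<mu>. norm (f x) powr p) powr (1 / p)"

text \<open>Complex linear span; the vector space structure is the pointwise one.\<close>

definition complex_span :: "('a \<Rightarrow> complex) set \<Rightarrow> ('a \<Rightarrow> complex) set" where
  "complex_span = module.span (\<lambda>c f x. c * f x)"

text \<open>Meaningful for \<open>S \<subseteq> Lp_space p \<mu>\<close>, since \<^const>\<open>Lp_norm\<close> is 0 on functions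
  whose \<open>p\<close>-th power is not integrable.\<close>

definition Lp_closed_span ::
    "real \<Rightarrow> 'a measure \<Rightarrow> ('a \<Rightarrow> complex) set \<Rightarrow> ('a \<Rightarrow> complex) set" where
  "Lp_closed_span p \<mu> S =
     {f \<in> Lp_space p \<mu>. \<forall>\<epsilon>>0. \<exists>g \<in> complex_span S. Lp_norm p \<mu> (\<lambda>x. f x - g x) < \<epsilon>}"

text \<open>Systems are indexed families: two different indices with the same element violate
  minimality.\<close>

definition Lp_complete :: "real \<Rightarrow> 'a measure \<Rightarrow> ('i \<Rightarrow> 'a \<Rightarrow> complex) \<Rightarrow> 'i set \<Rightarrow> bool" where
  "Lp_complete p \<mu> e I \<longleftrightarrow> Lp_closed_span p \<mu> (e ` I) = Lp_space p \<mu>"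

definition Lp_minimal :: "real \<Rightarrow> 'a measure \<Rightarrow> ('i \<Rightarrow> 'a \<Rightarrow> complex) \<Rightarrow> 'i set \<Rightarrow> bool" where
  "Lp_minimal p \<mu> e I \<longleftrightarrow> (\<forall>i\<in>I. e i \<notin> Lp_closed_span p \<mu> (e ` (I - {i})))"

text \<open>\<open>\<real>/2\<pi>\<int>\<close> is represented by the fundamental domain \<open>[0, 2\<pi>)\<close>. Borel measurability
  suffices, as every Lebesgue measurable function is almost everywhere equal to a Borel one.\<close>

definition circle :: "real measure" where
  "circle = restrict_space lborel {0..<2 * pi}"

definition torus2 :: "(real \<times> real) measure" where
  "torus2 = circle \<Otimes>\<^sub>M circle"

definition weighted_exponential ::
    "(real \<times> real \<Rightarrow> complex) \<Rightarrow> int \<times> int \<Rightarrow> real \<times> real \<Rightarrow> complex" where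
  "weighted_exponential M = (\<lambda>(k, m) (x, y).
     M (x, y) * exp (\<i> * of_int k * of_real x) * exp (\<i> * of_int m * of_real y))"

definition Omega0 :: "(int \<times> int) set" where
  "Omega0 = UNIV - ({0} \<times> (UNIV - {0}))"

end

theory Submission
  imports Defs
begin

text \<open>
  Let \<open>S\<close> be the closed linear span of the system
  without its element \<open>M\<close> of index \<open>(0, 0)\<close>.  If the system is complete and minimal, then
  \<open>M \<notin> S\<close> and \<open>L\<^sup>p = S \<oplus> \<complex> M\<close>, so \<open>L\<^sup>p / S\<close> is one-dimensional.  The remaining indices are
  exactly the \<open>(k, m)\<close> with \<open>k \<noteq> 0\<close>, a set invariant under \<open>m \<mapsto> m + 1\<close>; hence multiplication
  by \<open>\<phi> = e\<^sup>i\<^sup>y\<close> preserves \<open>S\<close> and acts on the one-dimensional quotient as a scalar \<open>c\<close>.  In other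
  words \<open>(\<phi> - c) L\<^sup>p \<subseteq> S\<close>.  But \<open>\<phi> - c\<close> vanishes only on a null set, so its multiples are
  dense in \<open>L\<^sup>p\<close>: every \<open>f\<close> is the limit of its restrictions to the sets \<open>\<bar>\<phi> - c\<bar> > 1 / n\<close>, on
  which one can divide by \<open>\<phi> - c\<close>.  Therefore \<open>S = L\<^sup>p\<close>, which contradicts \<open>M \<notin> S\<close>.

  The quotient appears below only through \<open>closed_span_insert\<close> (the scalar \<open>c\<close>),
  the multiplication operator through \<open>closed_span_multiplier\<close>, and the density through
  \<open>dense_multiples\<close>; \<open>redundant_if_complete_with_multiplier\<close> combines the three over an arbitrary
  measure space.
\<close>

section \<open>The \<open>p\<close>-th power of the norm\<close>

text \<open>
  Approximation is measured by \<open>\<integral> \<bar>f\<bar>\<^sup>p\<close> instead of the norm.  This quantity is small exactly when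
  the norm is, and the elementary inequality \<open>(a + b)\<^sup>p \<le> 2\<^sup>p (a\<^sup>p + b\<^sup>p)\<close> replaces Minkowski's.
\<close>

definition Lp_power :: "real \<Rightarrow> 'a measure \<Rightarrow> ('a \<Rightarrow> complex) \<Rightarrow> real" where
  "Lp_power p \<mu> f = (LINT x|\<mu>. norm (f x) powr p)"

lemma Lp_power_nonneg: "0 \<le> Lp_power p \<mu> f"
  by (simp add: Lp_power_def)

lemma Lp_norm_less_iff:
  assumes "0 < p" "0 < \<epsilon>"
  shows "Lp_norm p \<mu> f < \<epsilon> \<longleftrightarrow> Lp_power p \<mu> f < \<epsilon> powr p"
proof -
  have "Lp_power p \<mu> f = Lp_norm p \<mu> f powr p"
    using assms Lp_power_nonneg[of p \<mu> f]
    by (simp add: Lp_norm_def Lp_power_def powr_powr)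
  moreover have "0 \<le> Lp_norm p \<mu> f"
    by (simp add: Lp_norm_def)
  ultimately show ?thesis
    using assms powr_less_mono2[of p "Lp_norm p \<mu> f" \<epsilon>] powr_mono2[of p \<epsilon> "Lp_norm p \<mu> f"]
    by (cases "Lp_norm p \<mu> f < \<epsilon>") auto
qed

lemma Lp_dominated:
  assumes "0 < p" "f \<in> borel_measurable \<mu>" "g \<in> Lp_space p \<mu>" "0 \<le> C"
    and le: "\<And>x. x \<in> space \<mu> \<Longrightarrow> norm (f x) \<le> C * norm (g x)"
  shows "f \<in> Lp_space p \<mu>" "Lp_power p \<mu> f \<le> C powr p * Lp_power p \<mu> g"
proof -
  have *: "norm (f x) powr p \<le> C powr p * norm (g x) powr p" if "x \<in> space \<mu>" for x
    using powr_mono2[OF _ _ le[OF that], of p] assms(1,4) by (simp add: powr_mult)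
  have g: "integrable \<mu> (\<lambda>x. C powr p * norm (g x) powr p)"
    using assms(3) by (simp add: Lp_space_def)
  have f: "integrable \<mu> (\<lambda>x. norm (f x) powr p)"
    by (rule Bochner_Integration.integrable_bound[OF g]) (use assms(2) * in \<open>auto intro!: AE_I2\<close>)
  show "f \<in> Lp_space p \<mu>"
    using f assms(2) by (simp add: Lp_space_def)
  show "Lp_power p \<mu> f \<le> C powr p * Lp_power p \<mu> g"
    using integral_mono[OF f g] * by (simp add: Lp_power_def)
qed

lemma Lp_add:
  assumes "0 < p" "f \<in> Lp_space p \<mu>" "g \<in> Lp_space p \<mu>"
  shows "(\<lambda>x. f x + g x) \<in> Lp_space p \<mu>"
    and "Lp_power p \<mu> (\<lambda>x. f x + g x) \<le> 2 powr p * (Lp_power p \<mu> f + Lp_power p \<mu> g)"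
proof -
  have *: "norm (f x + g x) powr p \<le> 2 powr p * (norm (f x) powr p + norm (g x) powr p)" for x
  proof -
    have "norm (f x + g x) \<le> 2 * max (norm (f x)) (norm (g x))"
      using norm_triangle_ineq[of "f x" "g x"] by linarith
    then have "norm (f x + g x) powr p \<le> 2 powr p * max (norm (f x)) (norm (g x)) powr p"
      using powr_mono2[of p "norm (f x + g x)" "2 * max (norm (f x)) (norm (g x))"] assms(1)
      by (simp add: powr_mult)
    also have "\<dots> \<le> 2 powr p * (norm (f x) powr p + norm (g x) powr p)"
      by (intro mult_left_mono) (auto simp: max_def)
    finally show ?thesis .
  qed
  have h: "integrable \<mu> (\<lambda>x. 2 powr p * (norm (f x) powr p + norm (g x) powr p))"
    using assms by (simp add: Lp_space_def)
  have m: "(\<lambda>x. f x + g x) \<in> borel_measurable \<mu>"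
    using assms by (auto simp: Lp_space_def)
  have s: "integrable \<mu> (\<lambda>x. norm (f x + g x) powr p)"
    by (rule Bochner_Integration.integrable_bound[OF h]) (use m * in \<open>auto intro!: AE_I2\<close>)
  show "(\<lambda>x. f x + g x) \<in> Lp_space p \<mu>"
    using m s by (simp add: Lp_space_def)
  show "Lp_power p \<mu> (\<lambda>x. f x + g x) \<le> 2 powr p * (Lp_power p \<mu> f + Lp_power p \<mu> g)"
    using integral_mono[OF s h] * assms
    by (simp add: Lp_power_def Lp_space_def)
qed

lemma Lp_bounded_mult:
  assumes "0 < p" "f \<in> Lp_space p \<mu>" "\<phi> \<in> borel_measurable \<mu>" "0 \<le> C"
    and "\<And>x. x \<in> space \<mu> \<Longrightarrow> norm (\<phi> x) \<le> C"
  shows "(\<lambda>x. \<phi> x * f x) \<in> Lp_space p \<mu>"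
    and "Lp_power p \<mu> (\<lambda>x. \<phi> x * f x) \<le> C powr p * Lp_power p \<mu> f"
proof -
  have "(\<lambda>x. \<phi> x * f x) \<in> borel_measurable \<mu>"
    using assms by (auto simp: Lp_space_def)
  moreover have "norm (\<phi> x * f x) \<le> C * norm (f x)" if "x \<in> space \<mu>" for x
    using assms(5)[OF that] by (simp add: norm_mult mult_right_mono)
  ultimately show "(\<lambda>x. \<phi> x * f x) \<in> Lp_space p \<mu>"
    and "Lp_power p \<mu> (\<lambda>x. \<phi> x * f x) \<le> C powr p * Lp_power p \<mu> f"
    using Lp_dominated[of p "\<lambda>x. \<phi> x * f x" \<mu> f C] assms by auto
qed

lemma Lp_scale:
  assumes "0 < p" "f \<in> Lp_space p \<mu>"
  shows "(\<lambda>x. c * f x) \<in> Lp_space p \<mu>"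
    and "Lp_power p \<mu> (\<lambda>x. c * f x) = norm c powr p * Lp_power p \<mu> f"
  using Lp_bounded_mult(1)[OF assms, of "\<lambda>_. c" "norm c"]
  by (auto simp: Lp_power_def norm_mult powr_mult)

lemma Lp_diff:
  assumes "0 < p" "f \<in> Lp_space p \<mu>" "g \<in> Lp_space p \<mu>"
  shows "(\<lambda>x. f x - g x) \<in> Lp_space p \<mu>"
    and "Lp_power p \<mu> (\<lambda>x. f x - g x) \<le> 2 powr p * (Lp_power p \<mu> f + Lp_power p \<mu> g)"
  using Lp_add[OF assms(1,2) Lp_scale(1)[OF assms(1,3), of "-1"]]
    Lp_scale(2)[OF assms(1,3), of "-1"] by auto

section \<open>Closed spans\<close>

interpretation cfun: vector_space "\<lambda>(c::complex) f (x::'a). c * f x"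
  by unfold_locales (auto simp: plus_fun_def algebra_simps)

lemma complex_span_eq: "complex_span = cfun.span"
  by (simp add: complex_span_def)

lemma complex_span_add:
  "f \<in> complex_span S \<Longrightarrow> g \<in> complex_span S \<Longrightarrow> (\<lambda>x. f x + g x) \<in> complex_span S"
  using cfun.span_add[of f S g] by (simp add: complex_span_eq plus_fun_def)

lemma complex_span_scale: "f \<in> complex_span S \<Longrightarrow> (\<lambda>x. c * f x) \<in> complex_span S"
  using cfun.span_scale[of f S c] by (simp add: complex_span_eq)

lemma complex_span_subset_Lp:
  assumes "0 < p" "S \<subseteq> Lp_space p \<mu>"
  shows "complex_span S \<subseteq> Lp_space p \<mu>"
proof -
  have "cfun.subspace (Lp_space p \<mu>)"
    using Lp_add(1)[OF assms(1)] Lp_scale(1)[OF assms(1)] assms(1)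
    by (auto simp: cfun.subspace_def plus_fun_def zero_fun_def) (simp add: Lp_space_def)
  then show ?thesis
    using assms(2) by (simp add: complex_span_eq cfun.span_minimal)
qed

lemma Lp_closed_span_iff:
  assumes "0 < p"
  shows "f \<in> Lp_closed_span p \<mu> S \<longleftrightarrow>
    f \<in> Lp_space p \<mu> \<and> (\<forall>\<epsilon>>0. \<exists>g\<in>complex_span S. Lp_power p \<mu> (\<lambda>x. f x - g x) < \<epsilon>)"
proof -
  have "(\<forall>\<epsilon>>0. \<exists>g\<in>complex_span S. Lp_norm p \<mu> (\<lambda>x. f x - g x) < \<epsilon>) \<longleftrightarrow>
        (\<forall>\<epsilon>>0. \<exists>g\<in>complex_span S. Lp_power p \<mu> (\<lambda>x. f x - g x) < \<epsilon>)" (is "?A \<longleftrightarrow> ?B")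
  proof
    assume A: ?A
    show ?B
    proof (intro allI impI)
      fix \<epsilon> :: real
      assume \<epsilon>: "0 < \<epsilon>"
      then obtain g where "g \<in> complex_span S" "Lp_norm p \<mu> (\<lambda>x. f x - g x) < \<epsilon> powr (1 / p)"
        using A by (metis powr_gt_zero less_irrefl)
      then show "\<exists>g\<in>complex_span S. Lp_power p \<mu> (\<lambda>x. f x - g x) < \<epsilon>"
        using Lp_norm_less_iff[OF assms, of "\<epsilon> powr (1 / p)"] \<epsilon> assms
        by (auto simp: powr_powr)
    qed
  next
    assume ?B
    then show ?A
      by (simp add: Lp_norm_less_iff[OF assms])
  qed
  then show ?thesis
    by (simp add: Lp_closed_span_def)
qed

lemma closed_span_approx:
  assumes "0 < p" "f \<in> Lp_closed_span p \<mu> S" "0 < \<epsilon>"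
  obtains g where "g \<in> complex_span S" "Lp_power p \<mu> (\<lambda>x. f x - g x) < \<epsilon>"
  using assms(2,3) unfolding Lp_closed_span_iff[OF assms(1)] by blast

lemma Lp_closed_span_subset: "Lp_closed_span p \<mu> S \<subseteq> Lp_space p \<mu>"
  by (auto simp: Lp_closed_span_def)

lemma closed_span_superset:
  assumes "0 < p" "S \<subseteq> Lp_space p \<mu>"
  shows "complex_span S \<subseteq> Lp_closed_span p \<mu> S"
proof
  fix f assume "f \<in> complex_span S"
  moreover have "Lp_power p \<mu> (\<lambda>x. f x - f x) = 0"
    using assms by (simp add: Lp_power_def)
  ultimately show "f \<in> Lp_closed_span p \<mu> S"
    using complex_span_subset_Lp[OF assms] by (auto simp: Lp_closed_span_iff[OF assms(1)] intro!: bexI[of _ f])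
qed

lemma closed_span_closed:
  assumes "0 < p" "S \<subseteq> Lp_space p \<mu>" "f \<in> Lp_space p \<mu>"
    and approx: "\<And>\<epsilon>. 0 < \<epsilon> \<Longrightarrow> \<exists>g\<in>Lp_closed_span p \<mu> S. Lp_power p \<mu> (\<lambda>x. f x - g x) < \<epsilon>"
  shows "f \<in> Lp_closed_span p \<mu> S"
proof -
  have "\<exists>h\<in>complex_span S. Lp_power p \<mu> (\<lambda>x. f x - h x) < \<epsilon>" if "0 < \<epsilon>" for \<epsilon>
  proof -
    let ?\<delta> = "\<epsilon> / (2 * 2 powr p)"
    have \<delta>: "0 < ?\<delta>" using that by simp
    obtain g where g: "g \<in> Lp_closed_span p \<mu> S" "Lp_power p \<mu> (\<lambda>x. f x - g x) < ?\<delta>"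
      using approx[OF \<delta>] by blast
    obtain h where h: "h \<in> complex_span S" "Lp_power p \<mu> (\<lambda>x. g x - h x) < ?\<delta>"
      by (rule closed_span_approx[OF assms(1) g(1) \<delta>])
    have "g \<in> Lp_space p \<mu>" "h \<in> Lp_space p \<mu>"
      using g(1) h(1) Lp_closed_span_subset complex_span_subset_Lp[OF assms(1,2)] by blast+
    then have "Lp_power p \<mu> (\<lambda>x. (f x - g x) + (g x - h x))
        \<le> 2 powr p * (Lp_power p \<mu> (\<lambda>x. f x - g x) + Lp_power p \<mu> (\<lambda>x. g x - h x))"
      by (intro Lp_add(2) Lp_diff(1) assms)
    also have "\<dots> < 2 powr p * (?\<delta> + ?\<delta>)"
      using g(2) h(2) by (intro mult_strict_left_mono add_strict_mono) auto
    also have "\<dots> = \<epsilon>" by simp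
    finally show ?thesis using h(1) by auto
  qed
  then show ?thesis
    using assms(1,3) by (simp add: Lp_closed_span_iff)
qed

lemma closed_span_add:
  assumes "0 < p" "S \<subseteq> Lp_space p \<mu>" "f \<in> Lp_closed_span p \<mu> S" "g \<in> Lp_closed_span p \<mu> S"
  shows "(\<lambda>x. f x + g x) \<in> Lp_closed_span p \<mu> S"
proof -
  have Lp: "f \<in> Lp_space p \<mu>" "g \<in> Lp_space p \<mu>"
    using assms Lp_closed_span_subset by blast+
  have "\<exists>h\<in>complex_span S. Lp_power p \<mu> (\<lambda>x. f x + g x - h x) < \<epsilon>" if "0 < \<epsilon>" for \<epsilon>
  proof -
    let ?\<delta> = "\<epsilon> / (2 * 2 powr p)"
    have \<delta>: "0 < ?\<delta>" using that by simp
    obtain f' where f': "f' \<in> complex_span S" "Lp_power p \<mu> (\<lambda>x. f x - f' x) < ?\<delta>"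
      by (rule closed_span_approx[OF assms(1,3) \<delta>])
    obtain g' where g': "g' \<in> complex_span S" "Lp_power p \<mu> (\<lambda>x. g x - g' x) < ?\<delta>"
      by (rule closed_span_approx[OF assms(1,4) \<delta>])
    have "f' \<in> Lp_space p \<mu>" "g' \<in> Lp_space p \<mu>"
      using f'(1) g'(1) complex_span_subset_Lp[OF assms(1,2)] by blast+
    then have "Lp_power p \<mu> (\<lambda>x. (f x - f' x) + (g x - g' x))
        \<le> 2 powr p * (Lp_power p \<mu> (\<lambda>x. f x - f' x) + Lp_power p \<mu> (\<lambda>x. g x - g' x))"
      by (intro Lp_add(2) Lp_diff(1) assms Lp)
    also have "\<dots> < 2 powr p * (?\<delta> + ?\<delta>)"
      using f'(2) g'(2) by (intro mult_strict_left_mono add_strict_mono) auto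
    also have "\<dots> = \<epsilon>" by simp
    finally show ?thesis using complex_span_add[OF f'(1) g'(1)]
      by (intro bexI[of _ "\<lambda>x. f' x + g' x"]) (simp_all add: algebra_simps)
  qed
  then show ?thesis
    using Lp_add(1)[OF assms(1) Lp] by (simp add: Lp_closed_span_iff[OF assms(1)])
qed

lemma closed_span_scale:
  assumes "0 < p" "S \<subseteq> Lp_space p \<mu>" "f \<in> Lp_closed_span p \<mu> S"
  shows "(\<lambda>x. c * f x) \<in> Lp_closed_span p \<mu> S"
proof (rule closed_span_closed[OF assms(1,2)])
  show "(\<lambda>x. c * f x) \<in> Lp_space p \<mu>"
    using assms(3) Lp_closed_span_subset Lp_scale(1)[OF assms(1)] by blast
  show "\<exists>g\<in>Lp_closed_span p \<mu> S. Lp_power p \<mu> (\<lambda>x. c * f x - g x) < \<epsilon>" if "0 < \<epsilon>" for \<epsilon>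
  proof -
    have "0 < \<epsilon> / (norm c powr p + 1)"
      using that by (simp add: add_nonneg_pos)
    then obtain g where g: "g \<in> complex_span S"
        "Lp_power p \<mu> (\<lambda>x. f x - g x) < \<epsilon> / (norm c powr p + 1)"
      by (rule closed_span_approx[OF assms(1,3)])
    have "Lp_power p \<mu> (\<lambda>x. c * (f x - g x)) = norm c powr p * Lp_power p \<mu> (\<lambda>x. f x - g x)"
      by (simp add: Lp_power_def norm_mult powr_mult)
    also have "\<dots> \<le> (norm c powr p + 1) * Lp_power p \<mu> (\<lambda>x. f x - g x)"
      by (simp add: Lp_power_nonneg mult_right_mono)
    also have "\<dots> < \<epsilon>"
      using g(2) by (simp add: pos_less_divide_eq add_nonneg_pos mult.commute)
    finally show ?thesis
      using complex_span_scale[OF g(1), of c] closed_span_superset[OF assms(1,2)]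
      by (intro bexI[of _ "\<lambda>x. c * g x"]) (auto simp: algebra_simps)
  qed
qed

text \<open>
  Multiplication by \<open>\<phi>\<close> is a bounded linear operator, so it maps the closed span of \<open>R\<close>
  into the closed span of \<open>S\<close> as soon as it does so on the generators.
\<close>

lemma closed_span_multiplier:
  assumes "0 < p" "R \<subseteq> Lp_space p \<mu>" "S \<subseteq> Lp_space p \<mu>"
    and \<phi>: "\<phi> \<in> borel_measurable \<mu>" "0 \<le> C" "\<And>x. x \<in> space \<mu> \<Longrightarrow> norm (\<phi> x) \<le> C"
    and gen: "\<And>f. f \<in> R \<Longrightarrow> (\<lambda>x. \<phi> x * f x) \<in> Lp_closed_span p \<mu> S"
    and f: "f \<in> Lp_closed_span p \<mu> R"
  shows "(\<lambda>x. \<phi> x * f x) \<in> Lp_closed_span p \<mu> S"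
proof -
  note mult = Lp_bounded_mult[OF assms(1) _ \<phi>]
  have zero: "(\<lambda>_. 0) \<in> Lp_closed_span p \<mu> S"
    using closed_span_superset[OF assms(1,3)] cfun.span_zero[of S]
    by (auto simp: complex_span_eq zero_fun_def)
  have "cfun.subspace {h. (\<lambda>x. \<phi> x * h x) \<in> Lp_closed_span p \<mu> S}"
    using zero closed_span_add[OF assms(1,3)] closed_span_scale[OF assms(1,3)]
    by (auto simp: cfun.subspace_def plus_fun_def zero_fun_def distrib_left mult.left_commute)
  then have span: "(\<lambda>x. \<phi> x * h x) \<in> Lp_closed_span p \<mu> S" if "h \<in> complex_span R" for h
    using cfun.span_minimal[of R "{h. (\<lambda>x. \<phi> x * h x) \<in> Lp_closed_span p \<mu> S}"] gen that
    by (auto simp: complex_span_eq)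
  show ?thesis
  proof (rule closed_span_closed[OF assms(1,3)])
    have fL: "f \<in> Lp_space p \<mu>"
      using f Lp_closed_span_subset by blast
    then show "(\<lambda>x. \<phi> x * f x) \<in> Lp_space p \<mu>"
      by (rule mult(1))
    show "\<exists>g\<in>Lp_closed_span p \<mu> S. Lp_power p \<mu> (\<lambda>x. \<phi> x * f x - g x) < \<epsilon>" if "0 < \<epsilon>" for \<epsilon>
    proof -
      have "0 < \<epsilon> / (C powr p + 1)"
        using that by (simp add: add_nonneg_pos)
      then obtain g where g: "g \<in> complex_span R"
          "Lp_power p \<mu> (\<lambda>x. f x - g x) < \<epsilon> / (C powr p + 1)"
        by (rule closed_span_approx[OF assms(1) f])
      have "g \<in> Lp_space p \<mu>"
        using g(1) complex_span_subset_Lp[OF assms(1,2)] by blast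
      then have "Lp_power p \<mu> (\<lambda>x. \<phi> x * (f x - g x)) \<le> C powr p * Lp_power p \<mu> (\<lambda>x. f x - g x)"
        by (intro mult(2) Lp_diff(1) assms fL)
      also have "\<dots> \<le> (C powr p + 1) * Lp_power p \<mu> (\<lambda>x. f x - g x)"
        by (simp add: Lp_power_nonneg mult_right_mono)
      also have "\<dots> < \<epsilon>"
        using g(2) by (simp add: pos_less_divide_eq add_nonneg_pos mult.commute)
      finally show ?thesis
        using span[OF g(1)] by (intro bexI[of _ "\<lambda>x. \<phi> x * g x"]) (auto simp: algebra_simps)
    qed
  qed
qed

text \<open>
  A closed subspace plus a line is closed: if \<open>M\<close> has positive distance from the span of \<open>S\<close>,
  then the coefficients of \<open>M\<close> in a convergent sequence \<open>s\<^sub>n + a\<^sub>n M\<close> form a Cauchy sequence.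
\<close>

lemma closed_span_insert:
  assumes "0 < p" "S \<subseteq> Lp_space p \<mu>" "M \<in> Lp_space p \<mu>" "M \<notin> Lp_closed_span p \<mu> S"
    and f: "f \<in> Lp_closed_span p \<mu> (insert M S)"
  obtains c where "(\<lambda>x. f x - c * M x) \<in> Lp_closed_span p \<mu> S"
proof -
  have fL: "f \<in> Lp_space p \<mu>"
    using f Lp_closed_span_subset by blast
  obtain \<delta> where \<delta>: "0 < \<delta>" "\<And>g. g \<in> complex_span S \<Longrightarrow> \<delta> \<le> Lp_power p \<mu> (\<lambda>x. M x - g x)"
    using assms(3,4) by (auto simp: Lp_closed_span_iff[OF assms(1)] not_less)
  \<comment> \<open>By homogeneity this reduces to coefficient 1, where \<open>\<delta>\<close> is a lower bound.\<close>
  have dist: "norm c powr p * \<delta> \<le> Lp_power p \<mu> (\<lambda>x. c * M x + s x)"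
    if s: "s \<in> complex_span S" for c s
  proof (cases "c = 0")
    case True
    then show ?thesis using assms(1) by (simp add: Lp_power_nonneg)
  next
    case False
    have "norm c powr p * \<delta> \<le> norm c powr p * Lp_power p \<mu> (\<lambda>x. M x - (- 1 / c) * s x)"
      using \<delta>(2)[OF complex_span_scale[OF s, of "- 1 / c"]] by (intro mult_left_mono) auto
    also have "\<dots> = Lp_power p \<mu> (\<lambda>x. c * (M x - (- 1 / c) * s x))"
      by (simp add: Lp_power_def norm_mult powr_mult)
    also have "(\<lambda>x. c * (M x - (- 1 / c) * s x)) = (\<lambda>x. c * M x + s x)"
      using False by (auto simp: field_simps)
    finally show ?thesis .
  qed
  have "\<exists>a s. s \<in> complex_span S \<and> Lp_power p \<mu> (\<lambda>x. f x - (a * M x + s x)) < 1 / real (Suc n)"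
    for n
  proof -
    have "0 < 1 / real (Suc n)" by simp
    then obtain g where g: "g \<in> complex_span (insert M S)"
        "Lp_power p \<mu> (\<lambda>x. f x - g x) < 1 / real (Suc n)"
      by (rule closed_span_approx[OF assms(1) f])
    obtain a where a: "g - (\<lambda>x. a * M x) \<in> complex_span S"
      using g(1) cfun.span_breakdown_eq[of g M S] by (auto simp: complex_span_eq)
    then show ?thesis
      using g(2) by (intro exI[of _ a] exI[of _ "g - (\<lambda>x. a * M x)"]) simp
  qed
  then obtain a s where s: "\<And>n. s n \<in> complex_span S"
    and as: "\<And>n. Lp_power p \<mu> (\<lambda>x. f x - (a n * M x + s n x)) < 1 / real (Suc n)"
    by metis
  have sL: "s n \<in> Lp_space p \<mu>" for n
    using s complex_span_subset_Lp[OF assms(1,2)] by blast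
  have asL: "(\<lambda>x. f x - (a n * M x + s n x)) \<in> Lp_space p \<mu>" for n
    by (intro Lp_diff(1) Lp_add(1) Lp_scale(1) assms fL sL)
  \<comment> \<open>Both approximants are close to \<open>f\<close>, hence to each other; their difference has
      \<open>M\<close>-coefficient \<open>a m - a n\<close>.\<close>
  have bound: "norm (a m - a n) powr p * \<delta> \<le> 2 powr p * (1 / real (Suc n) + 1 / real (Suc m))"
    for m n
  proof -
    have "norm (a m - a n) powr p * \<delta>
        \<le> Lp_power p \<mu> (\<lambda>x. (a m - a n) * M x + (s m x + (- 1) * s n x))"
      by (intro dist complex_span_add complex_span_scale s)
    also have "\<dots> = Lp_power p \<mu> (\<lambda>x. (f x - (a n * M x + s n x)) - (f x - (a m * M x + s m x)))"
      by (simp add: algebra_simps)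
    also have "\<dots> \<le> 2 powr p * (Lp_power p \<mu> (\<lambda>x. f x - (a n * M x + s n x))
        + Lp_power p \<mu> (\<lambda>x. f x - (a m * M x + s m x)))"
      by (rule Lp_diff(2)[OF assms(1) asL asL])
    also have "\<dots> \<le> 2 powr p * (1 / real (Suc n) + 1 / real (Suc m))"
      using as[of n] as[of m] by (intro mult_left_mono add_mono) auto
    finally show ?thesis .
  qed
  have "Cauchy a"
  proof (rule metric_CauchyI)
    fix e :: real
    assume e: "0 < e"
    obtain N where N: "inverse (real (Suc N)) < e powr p * \<delta> / (2 * 2 powr p)"
      using reals_Archimedean[of "e powr p * \<delta> / (2 * 2 powr p)"] e \<delta> by auto
    have "dist (a m) (a n) < e" if "N \<le> m" "N \<le> n" for m n
    proof (rule ccontr)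
      assume "\<not> ?thesis"
      then have "e powr p * \<delta> \<le> norm (a m - a n) powr p * \<delta>"
        using assms(1) e \<delta> by (intro mult_right_mono powr_mono2) (auto simp: dist_norm)
      also have "\<dots> \<le> 2 powr p * (1 / real (Suc n) + 1 / real (Suc m))"
        by (rule bound)
      also have "\<dots> \<le> 2 powr p * (inverse (real (Suc N)) + inverse (real (Suc N)))"
        using that by (intro mult_left_mono add_mono) (auto simp: field_simps)
      also have "\<dots> < e powr p * \<delta>"
        using N by (simp add: field_simps)
      finally show False by simp
    qed
    then show "\<exists>N. \<forall>m\<ge>N. \<forall>n\<ge>N. dist (a m) (a n) < e" by blast
  qed
  then obtain c where c: "a \<longlonglongrightarrow> c"
    using Cauchy_convergent convergent_def by blast
  have "(\<lambda>x. f x - c * M x) \<in> Lp_closed_span p \<mu> S"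
  proof -
    have "\<exists>g\<in>complex_span S. Lp_power p \<mu> (\<lambda>x. f x - c * M x - g x) < \<epsilon>" if "0 < \<epsilon>" for \<epsilon>
    proof -
      let ?B = "\<lambda>n. 2 powr p * (1 / real (Suc n) + norm (a n - c) powr p * Lp_power p \<mu> M)"
      have "(\<lambda>n. norm (a n - c) powr p) \<longlonglongrightarrow> 0"
      proof -
        have "(\<lambda>n. norm (a n - c)) \<longlonglongrightarrow> 0"
          using c by (simp add: LIM_zero tendsto_norm_zero)
        then show ?thesis
          using assms(1) by (intro tendsto_zero_powrI[where b = p]) auto
      qed
      then have "?B \<longlonglongrightarrow> 2 powr p * (0 + 0 * Lp_power p \<mu> M)"
        by (intro tendsto_intros lim_inverse_n'[THEN LIMSEQ_Suc])
      then have "eventually (\<lambda>n. ?B n < \<epsilon>) sequentially"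
        using that by (intro order_tendstoD(2)) auto
      then obtain n where n: "?B n < \<epsilon>"
        by (auto simp: eventually_sequentially)
      have "Lp_power p \<mu> (\<lambda>x. (f x - (a n * M x + s n x)) + (a n - c) * M x)
          \<le> 2 powr p * (Lp_power p \<mu> (\<lambda>x. f x - (a n * M x + s n x))
              + Lp_power p \<mu> (\<lambda>x. (a n - c) * M x))"
        by (rule Lp_add(2)[OF assms(1) asL Lp_scale(1)[OF assms(1,3)]])
      also have "\<dots> \<le> ?B n"
        using as[of n] Lp_scale(2)[OF assms(1,3), of "a n - c"]
        by (intro mult_left_mono add_mono) auto
      also have "\<dots> < \<epsilon>" by (rule n)
      finally show ?thesis
        using s[of n] by (intro bexI[of _ "s n"]) (simp_all add: algebra_simps)
    qed
    then show ?thesis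
      using Lp_diff(1)[OF assms(1) fL Lp_scale(1)[OF assms(1,3)], of c]
      by (simp add: Lp_closed_span_iff[OF assms(1)])
  qed
  then show thesis by (rule that)
qed

section \<open>Multipliers and codimension one\<close>

text \<open>
  Where \<open>\<bar>\<psi>\<bar> > 1 / n\<close> one can divide by \<open>\<psi>\<close>, so the restriction of \<open>f\<close> to that set is a multiple
  of \<open>\<psi>\<close>.  These restrictions converge to \<open>f\<close> by dominated convergence.
\<close>

lemma dense_multiples:
  assumes "0 < p" "S \<subseteq> Lp_space p \<mu>"
    and \<psi>: "\<psi> \<in> borel_measurable \<mu>" "AE x in \<mu>. \<psi> x \<noteq> 0"
    and mult: "\<And>f. f \<in> Lp_space p \<mu> \<Longrightarrow> (\<lambda>x. \<psi> x * f x) \<in> Lp_closed_span p \<mu> S"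
    and f: "f \<in> Lp_space p \<mu>"
  shows "f \<in> Lp_closed_span p \<mu> S"
proof (rule closed_span_closed[OF assms(1,2) f])
  note [measurable] = \<psi>(1)
  have fm [measurable]: "f \<in> borel_measurable \<mu>" and fi: "integrable \<mu> (\<lambda>x. norm (f x) powr p)"
    using f by (auto simp: Lp_space_def)
  \<comment> \<open>The reciprocal of \<open>\<psi>\<close> cut off to be bounded by \<open>n + 1\<close>, so that \<open>q n * f\<close> stays in \<open>L\<^sup>p\<close>.\<close>
  define q where "q = (\<lambda>n x. if norm (\<psi> x) > inverse (real (Suc n)) then inverse (\<psi> x) else 0)"
  have q: "(\<lambda>x. q n x * f x) \<in> Lp_space p \<mu>" for n
  proof (rule Lp_bounded_mult(1)[OF assms(1) f, where C = "real (Suc n)"])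
    show "q n \<in> borel_measurable \<mu>"
      unfolding q_def by measurable
    show "norm (q n x) \<le> real (Suc n)" for x
      using le_imp_inverse_le[of "inverse (real (Suc n))" "norm (\<psi> x)"]
      by (auto simp: q_def norm_inverse)
  qed simp
  have residual: "f x - \<psi> x * (q n x * f x) =
      (if norm (\<psi> x) > inverse (real (Suc n)) then 0 else f x)" for n x
  proof (cases "norm (\<psi> x) > inverse (real (Suc n))")
    case True
    then have "\<psi> x \<noteq> 0"
      by (metis inverse_nonnegative_iff_nonnegative norm_zero not_le of_nat_0_le_iff)
    with True show ?thesis by (simp add: q_def mult.assoc[symmetric])
  qed (simp add: q_def)
  have "(\<lambda>n. LINT x|\<mu>. norm (f x - \<psi> x * (q n x * f x)) powr p) \<longlonglongrightarrow> (LINT x|\<mu>. 0)"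
  proof (rule integral_dominated_convergence[OF _ _ fi])
    show "AE x in \<mu>. (\<lambda>n. norm (f x - \<psi> x * (q n x * f x)) powr p) \<longlonglongrightarrow> 0"
      using \<psi>(2)
    proof eventually_elim
      case (elim x)
      then obtain N where N: "inverse (real (Suc N)) < norm (\<psi> x)"
        using reals_Archimedean[of "norm (\<psi> x)"] by auto
      have "norm (f x - \<psi> x * (q n x * f x)) powr p = 0" if "N \<le> n" for n
      proof -
        have "inverse (real (Suc n)) \<le> inverse (real (Suc N))"
          using that by (intro le_imp_inverse_le) auto
        with N have "inverse (real (Suc n)) < norm (\<psi> x)" by linarith
        then show ?thesis
          by (simp add: residual)
      qed
      then show ?case
        by (intro tendsto_eventually) (auto simp: eventually_sequentially)
    qed
    show "AE x in \<mu>. norm (norm (f x - \<psi> x * (q n x * f x)) powr p) \<le> norm (f x) powr p" for n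
      by (intro AE_I2) (simp add: residual)
    show "(\<lambda>x. norm (f x - \<psi> x * (q n x * f x)) powr p) \<in> borel_measurable \<mu>" for n
      using q[of n] fm \<psi>(1) by (auto simp: Lp_space_def)
  qed simp
  then have lim: "(\<lambda>n. Lp_power p \<mu> (\<lambda>x. f x - \<psi> x * (q n x * f x))) \<longlonglongrightarrow> 0"
    by (simp add: Lp_power_def)
  fix \<epsilon> :: real
  assume "0 < \<epsilon>"
  then obtain n where "Lp_power p \<mu> (\<lambda>x. f x - \<psi> x * (q n x * f x)) < \<epsilon>"
    using order_tendstoD(2)[OF lim] by (auto simp: eventually_sequentially)
  then show "\<exists>g\<in>Lp_closed_span p \<mu> S. Lp_power p \<mu> (\<lambda>x. f x - g x) < \<epsilon>"
    using mult[OF q[of n]] by (intro bexI)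
qed

text \<open>
  The closed span of a \<open>\<phi>\<close>-invariant system cannot have codimension one when every level set
  of \<open>\<phi>\<close> is null: \<open>\<phi>\<close> would act on the quotient by a scalar \<open>c\<close>, and the multiples of
  \<open>\<phi> - c\<close>, which are dense, would all lie in that closed span.
\<close>

lemma redundant_if_complete_with_multiplier:
  assumes "0 < p" "S \<subseteq> Lp_space p \<mu>" "M \<in> Lp_space p \<mu>"
    and \<phi>: "\<phi> \<in> borel_measurable \<mu>" "0 \<le> C" "\<And>x. x \<in> space \<mu> \<Longrightarrow> norm (\<phi> x) \<le> C"
    and nonconst: "\<And>c. AE x in \<mu>. \<phi> x \<noteq> c"
    and inv: "\<And>f. f \<in> S \<Longrightarrow> (\<lambda>x. \<phi> x * f x) \<in> S"
    and complete: "Lp_closed_span p \<mu> (insert M S) = Lp_space p \<mu>"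
  shows "M \<in> Lp_closed_span p \<mu> S"
proof (rule ccontr)
  assume M: "M \<notin> Lp_closed_span p \<mu> S"
  have base: "S \<subseteq> Lp_closed_span p \<mu> S"
    using closed_span_superset[OF assms(1,2)] cfun.span_superset[of S]
    by (auto simp: complex_span_eq)
  have "(\<lambda>x. \<phi> x * M x) \<in> Lp_closed_span p \<mu> (insert M S)"
    using Lp_bounded_mult(1)[OF assms(1,3) \<phi>] complete by simp
  then obtain c where c: "(\<lambda>x. \<phi> x * M x - c * M x) \<in> Lp_closed_span p \<mu> S"
    using closed_span_insert[OF assms(1-3) M] by blast
  have gen: "(\<lambda>x. (\<phi> x - c) * f x) \<in> Lp_closed_span p \<mu> S" if "f \<in> insert M S" for f
  proof (cases "f = M")
    case True
    then show ?thesis using c by (simp add: algebra_simps)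
  next
    case False
    then have "f \<in> S" using that by simp
    then have "(\<lambda>x. \<phi> x * f x + (- c) * f x) \<in> Lp_closed_span p \<mu> S"
      using inv base by (intro closed_span_add closed_span_scale assms) auto
    then show ?thesis by (simp add: algebra_simps)
  qed
  have "(\<lambda>x. (\<phi> x - c) * f x) \<in> Lp_closed_span p \<mu> S" if "f \<in> Lp_space p \<mu>" for f
  proof (rule closed_span_multiplier[where R = "insert M S" and C = "C + norm c"])
    show "norm (\<phi> x - c) \<le> C + norm c" if "x \<in> space \<mu>" for x
      using \<phi>(3)[OF that] norm_triangle_ineq4[of "\<phi> x" c] by linarith
  qed (use assms gen that in auto)
  then have "M \<in> Lp_closed_span p \<mu> S"
  proof (rule dense_multiples[OF assms(1,2), where \<psi> = "\<lambda>x. \<phi> x - c", rotated 2])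
    show "(\<lambda>x. \<phi> x - c) \<in> borel_measurable \<mu>"
      using \<phi>(1) by simp
    show "AE x in \<mu>. \<phi> x - c \<noteq> 0"
      using nonconst[of c] by simp
  qed (use assms(3) in simp_all)
  with M show False by simp
qed

section \<open>Weighted exponentials on the torus\<close>

lemma borel_measurable_torus2:
  assumes "f \<in> borel_measurable borel"
  shows "f \<in> borel_measurable torus2"
proof -
  have [measurable]: "(\<lambda>x. x) \<in> borel_measurable circle"
    unfolding circle_def by (rule measurable_restrict_space1) simp
  have "(\<lambda>z. (fst z, snd z)) \<in> torus2 \<rightarrow>\<^sub>M borel \<Otimes>\<^sub>M borel"
    unfolding torus2_def
    by (intro measurable_Pair measurable_compose[OF measurable_fst \<open>(\<lambda>x. x) \<in> _\<close>]
        measurable_compose[OF measurable_snd \<open>(\<lambda>x. x) \<in> _\<close>])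
  then show ?thesis
    using measurable_compose[of "\<lambda>z. z" torus2 borel f] assms by (simp add: borel_prod)
qed

lemma AE_exp_snd_neq: "AE z in torus2. exp (\<i> * of_real (snd z)) \<noteq> c"
proof -
  interpret C: finite_measure circle
    by (rule finite_measureI)
       (simp add: circle_def emeasure_restrict_space space_restrict_space)
  interpret P: pair_sigma_finite circle circle ..
  have "AE y in circle. exp (\<i> * of_real y) \<noteq> c"
  proof -
    have eq: "y = z" if y: "y \<in> {0..<2 * pi}" and z: "z \<in> {0..<2 * pi}"
        and e: "exp (\<i> * of_real y) = exp (\<i> * of_real z)" for y z
    proof -
      obtain n :: int where n: "\<i> * of_real y = \<i> * of_real z + of_int (2 * n) * of_real pi * \<i>"
        using e unfolding exp_eq by auto
      then have yz: "y = z + 2 * of_int n * pi"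
        by (auto simp: complex_eq_iff)
      have "\<bar>2 * of_int n * pi\<bar> < 2 * pi"
        using y z yz by auto
      then have "\<bar>real_of_int n\<bar> < 1"
        by (simp add: abs_mult)
      then show ?thesis using yz by simp
    qed
    obtain y0 where y0: "\<forall>y \<in> {0..<2 * pi}. exp (\<i> * of_real y) = c \<longrightarrow> y = y0"
      using eq by (cases "\<exists>y \<in> {0..<2 * pi}. exp (\<i> * of_real y) = c") blast+
    have "AE y in lborel. y \<noteq> y0"
      by (rule AE_lborel_singleton)
    then have "AE y in lborel. y \<in> {0..<2 * pi} \<longrightarrow> exp (\<i> * of_real y) \<noteq> c"
      by eventually_elim (use y0 in blast)
    then show ?thesis
      unfolding circle_def by (subst AE_restrict_space_iff) auto
  qed
  moreover have "(\<lambda>z. exp (\<i> * of_real (snd z)) :: complex) \<in> borel_measurable torus2"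
    by (intro borel_measurable_torus2 borel_measurable_continuous_onI continuous_intros)
  then have "{z \<in> space torus2. exp (\<i> * of_real (snd z)) \<noteq> c} \<in> sets torus2"
    by measurable
  ultimately show ?thesis
    unfolding torus2_def by (intro P.AE_pair_measure) simp_all
qed

theorem proposition4:
  fixes p :: real and M :: "real \<times> real \<Rightarrow> complex"
  assumes "1 \<le> p"
    and "M \<in> Lp_space p torus2"
  shows "\<not> (Lp_complete p torus2 (weighted_exponential M) Omega0 \<and>
            Lp_minimal p torus2 (weighted_exponential M) Omega0)"
proof
  let ?e = "weighted_exponential M"
  let ?S = "?e ` (Omega0 - {(0, 0)})"
  define \<phi> :: "real \<times> real \<Rightarrow> complex" where "\<phi> = (\<lambda>z. exp (\<i> * of_real (snd z)))"
  assume "Lp_complete p torus2 ?e Omega0 \<and> Lp_minimal p torus2 ?e Omega0"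
  moreover have zero: "(0, 0) \<in> Omega0"
    by (simp add: Omega0_def)
  moreover have e0: "?e (0, 0) = M"
    by (auto simp: weighted_exponential_def)
  ultimately have complete: "Lp_closed_span p torus2 (?e ` Omega0) = Lp_space p torus2"
    and minimal: "M \<notin> Lp_closed_span p torus2 ?S"
    by (metis Lp_complete_def, metis Lp_minimal_def)
  have p: "0 < p" using assms(1) by simp
  have eL: "?e km \<in> Lp_space p torus2" for km
  proof -
    obtain k m where km: "km = (k, m)" by fastforce
    have "(\<lambda>z. (exp (\<i> * of_int k * of_real (fst z)) * exp (\<i> * of_int m * of_real (snd z))) * M z)
        \<in> Lp_space p torus2"
    proof (rule Lp_bounded_mult(1)[OF p assms(2), where C = 1])
      show "(\<lambda>z. exp (\<i> * of_int k * of_real (fst z)) * exp (\<i> * of_int m * of_real (snd z)))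
          \<in> borel_measurable torus2"
        by (intro borel_measurable_torus2 borel_measurable_continuous_onI continuous_intros)
    qed (simp_all add: norm_mult)
    then show ?thesis
      by (simp add: km weighted_exponential_def case_prod_unfold mult_ac)
  qed
  have "M \<in> Lp_closed_span p torus2 ?S"
  proof (rule redundant_if_complete_with_multiplier[where \<phi> = \<phi> and C = 1])
    show "\<phi> \<in> borel_measurable torus2"
      unfolding \<phi>_def
      by (intro borel_measurable_torus2 borel_measurable_continuous_onI continuous_intros)
    show "AE z in torus2. \<phi> z \<noteq> c" for c
      unfolding \<phi>_def by (rule AE_exp_snd_neq)
    show "(\<lambda>z. \<phi> z * f z) \<in> ?S" if f: "f \<in> ?S" for f
    proof -
      obtain k m where km: "f = ?e (k, m)" "k \<noteq> 0"
        using f by (auto simp: Omega0_def)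
      have "(\<lambda>z. \<phi> z * f z) = ?e (k, m + 1)"
        by (auto simp: km \<phi>_def weighted_exponential_def algebra_simps exp_add)
      moreover have "(k, m + 1) \<in> Omega0 - {(0, 0)}"
        using km(2) by (simp add: Omega0_def)
      ultimately show ?thesis by blast
    qed
    have "insert M ?S = ?e ` Omega0"
      using zero e0 by (metis image_insert insert_Diff)
    then show "Lp_closed_span p torus2 (insert M ?S) = Lp_space p torus2"
      using complete by simp
  qed (use p assms(2) eL in \<open>auto simp: \<phi>_def\<close>)
  with minimal show False by simp
qed

end
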